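(* Let $n$ be a positive integer and let $R(3,\mathbb{Z}_n,2)$ denote the minimal number of monochromatic $3$-term arithmetic progressions in any two-coloring of $\mathbb{Z}_n$. Then \[ \frac{n^2}{8}-c_1n+c_2 \leq R(3,\mathbb{Z}_n,2) \leq \frac{n^2}{8}-c_1n+c_3, \] where the constants $c_1,c_2,c_3$ depend on $n \bmod 24$ as follows: \[ \begin{array}{c|c|c|c} n \bmod 24 & c_1 & c_2 & c_3 \\ \hline 1,5,7,11,13,17,19,23 & 1/2 & 3/8 & 3/8 \\ 8,16 & 1 & 0 & 0 \\ 2,10 & 1 & 3/2 & 3/2 \\ 4,20 & 1 & 0 & 2 \\ 14,22 & 1 & 3/2 & 3/2 \\ 3,9,15,21 & 7/6 & 3/8 & 27/8 \\ 0 & 5/3 & 0 & 0 \\ 12 & 5/3 & 0 & 18 \\ 6,18 & 5/3 & 1/2 & 27/2 \end{array} \]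
   Context: A $3$-term arithmetic progression in $\mathbb{Z}_n$ is a $3$-element set (three distinct elements) of the form $\{a,a+b,a+2b\}$ with $a\in\mathbb{Z}_n$ and $b\in\mathbb{Z}_n\setminus\{0\}$; progressions are counted as sets, so each set is counted once regardless of how many pairs $(a,b)$ produce it. A two-coloring of $\mathbb{Z}_n$ is a map $\chi:\mathbb{Z}_n\to\{-1,1\}$, and a progression is monochromatic if $\chi$ is constant on it. $R(3,\mathbb{Z}_n,2)$ is the minimum, over all two-colorings of $\mathbb{Z}_n$, of the number of monochromatic $3$-term arithmetic progressions. *)

theory Defs
  imports Complex_Main "HOL-Library.FuncSet" "HOL-Number_Theory.Residues"
begin

text \<open>
  The group \<open>\<int>\<^sub>n\<close> is the additive group of the library's \<^const>\<open>residue_ring\<close>, whose carrier is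
  \<open>{0..int n - 1}\<close>. This is also meaningful for \<open>n = 1\<close>, where it is the trivial group (the locale
  \<^locale>\<open>residues\<close> would exclude that case).
\<close>

definition three_aps :: "nat \<Rightarrow> int set set" where
  "three_aps n =
    (let G = residue_ring (int n) in
      {P. card P = 3 \<and>
          (\<exists>a \<in> carrier G. \<exists>b \<in> carrier G - {\<zero>\<^bsub>G\<^esub>}.
             P = {a, a \<oplus>\<^bsub>G\<^esub> b, a \<oplus>\<^bsub>G\<^esub> (b \<oplus>\<^bsub>G\<^esub> b)})})"

text \<open>
  The extensional function space makes the set of colorings finite, so that the minimum
  below is taken over a finite nonempty set.
\<close>

definition two_colorings :: "nat \<Rightarrow> (int \<Rightarrow> int) set" where
  "two_colorings n = carrier (residue_ring (int n)) \<rightarrow>\<^sub>E {-1, 1}"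

definition monochromatic :: "(int \<Rightarrow> int) \<Rightarrow> int set \<Rightarrow> bool" where
  "monochromatic \<chi> P \<longleftrightarrow> (\<forall>x\<in>P. \<forall>y\<in>P. \<chi> x = \<chi> y)"

definition min_mono_three_aps :: "nat \<Rightarrow> nat" where
  "min_mono_three_aps n =
    Min ((\<lambda>\<chi>. card {P \<in> three_aps n. monochromatic \<chi> P}) ` two_colorings n)"

text \<open>The triples \<open>(c\<^sub>1, c\<^sub>2, c\<^sub>3)\<close>; the last branch is reached exactly for the residues 6 and 18.\<close>

definition bound_constants :: "nat \<Rightarrow> real \<times> real \<times> real" where
  "bound_constants n =
    (let r = n mod 24 in
      if r \<in> {1, 5, 7, 11, 13, 17, 19, 23} then (1/2, 3/8, 3/8)
      else if r \<in> {8, 16} then (1, 0, 0)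
      else if r \<in> {2, 10} then (1, 3/2, 3/2)
      else if r \<in> {4, 20} then (1, 0, 2)
      else if r \<in> {14, 22} then (1, 3/2, 3/2)
      else if r \<in> {3, 9, 15, 21} then (7/6, 3/8, 27/8)
      else if r = 0 then (5/3, 0, 0)
      else if r = 12 then (5/3, 0, 18)
      else (5/3, 1/2, 27/2))"

end

(*
  Extend a colouring to an n-periodic sign function X on the integers. A progression is indexed by
  its first element a and its difference b with 0 < b < n/2 (where 3b = n, only a < b is kept: these
  progressions are the cosets of the subgroup of order 3). With C(b) = sum_a X(a) X(a + b), the number
  w(b) of monochromatic progressions with difference b satisfies 4 w(b) = n + 2 C(b) + C(2b). Summing
  over b turns the count into a quadratic form in the colour sums S, E, O over all, the even and
  the odd residues, with the terms w(0), w(n/2) and two thirds of w(n/3) removed. Lower bound: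
  w(b) <= n, and E, O (or S, for odd n) have a known parity; the constant 3/2 for n = 2 mod 4 also
  uses that w(n/2) = n forces E = O. Upper bound: the pattern + - - + repeated with
  period n/k, where k is 1, 2, 3 or 6, is constant on all degenerate progressions.
*)

theory Submission
  imports Defs
begin

section \<open>Progressions indexed by first element and difference\<close>

definition ap_set :: "int \<Rightarrow> int \<times> int \<Rightarrow> int set" where
  "ap_set N = (\<lambda>(a, b). {a mod N, (a + b) mod N, (a + 2 * b) mod N})"

text \<open>Differences \<open>b\<close> and \<open>N - b\<close> produce the same sets, and
  \<open>2 * b = N\<close> produces only two elements. When \<open>3 * b = N\<close>, moving the
  start by \<open>b\<close> merely permutes the three elements, so one start out of three is
  kept.\<close>

definition ap_index :: "int \<Rightarrow> (int \<times> int) set" where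
  "ap_index N = {(a, b). 0 \<le> a \<and> a < N \<and> 0 < b \<and> 2 * b < N \<and> (3 * b = N \<longrightarrow> a < b)}"

text \<open>Turns a congruence between small numbers into three linear equations, so that linear
  arithmetic can finish the cases.\<close>

lemma dvd_small_cases:
  fixes N x :: int
  assumes "N dvd x" "- 2 * N < x" "x < 2 * N"
  shows "x = - N \<or> x = 0 \<or> x = N"
proof -
  obtain k where k: "x = N * k" using assms(1) by blast
  have "0 < N" using assms(2,3) by linarith
  have "N * (-2) < N * k" "N * k < N * 2" using k assms(2,3) by linarith+
  then have "-2 < k" "k < 2"
    unfolding mult_less_cancel_left_pos[OF \<open>0 < N\<close>] .
  then have "k = -1 \<or> k = 0 \<or> k = 1" by linarith
  then show ?thesis using k by auto
qed

text \<open>The terms of the second progression are the terms of the first at positions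
  \<open>i\<close>, \<open>j\<close>, \<open>k\<close>. Comparing consecutive terms forces
  \<open>d = b\<close>, and the order is the original one or, if \<open>3 * b = N\<close>, a cyclic
  rotation; the condition that both starts lie below \<open>b\<close> excludes the nontrivial
  rotations.\<close>

lemma inj_on_ap_set: "inj_on (ap_set N) (ap_index N)"
proof (rule inj_onI, clarify)
  fix a b c d
  assume ab: "(a, b) \<in> ap_index N" and cd: "(c, d) \<in> ap_index N"
    and eq: "ap_set N (a, b) = ap_set N (c, d)"
  have bounds: "0 \<le> a" "a < N" "0 < b" "2 * b < N" "3 * b = N \<longrightarrow> a < b"
    "0 \<le> c" "c < N" "0 < d" "2 * d < N" "3 * d = N \<longrightarrow> c < d"
    using ab cd by (auto simp: ap_index_def)
  have "c mod N \<in> ap_set N (a, b)" "(c + d) mod N \<in> ap_set N (a, b)"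
    "(c + 2 * d) mod N \<in> ap_set N (a, b)"
    unfolding eq by (auto simp: ap_set_def)
  moreover have "ap_set N (a, b) = (\<lambda>i. (a + i * b) mod N) ` {0, 1, 2}"
    by (simp add: ap_set_def)
  ultimately have image: "c mod N \<in> (\<lambda>i. (a + i * b) mod N) ` {0, 1, 2}"
    "(c + d) mod N \<in> (\<lambda>i. (a + i * b) mod N) ` {0, 1, 2}"
    "(c + 2 * d) mod N \<in> (\<lambda>i. (a + i * b) mod N) ` {0, 1, 2}"
    by simp_all
  obtain i where i: "i \<in> {0, 1, 2}" "c mod N = (a + i * b) mod N"
    using image(1) by (rule imageE)
  obtain j where j: "j \<in> {0, 1, 2}" "(c + d) mod N = (a + j * b) mod N"
    using image(2) by (rule imageE)
  obtain k where k: "k \<in> {0, 1, 2}" "(c + 2 * d) mod N = (a + k * b) mod N"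
    using image(3) by (rule imageE)
  note ijk = i(1) j(1) k(1) i(2) j(2) k(2)
  have "N dvd c - (a + i * b)" and "N dvd c + d - (a + j * b)" and "N dvd c + 2 * d - (a + k * b)"
    using ijk by (simp_all only: mod_eq_dvd_iff)
  then have dvds: "N dvd c - (a + i * b)" "N dvd (c + d - (a + j * b)) - (c - (a + i * b))"
    "N dvd (c + 2 * d - (a + k * b)) - (c + d - (a + j * b))"
    by (blast intro: dvd_diff)+
  \<comment> \<open>Here \<open>q\<close> is the number of positions moved. Since \<open>b\<close>
    and \<open>d\<close> lie strictly between 0 and \<open>N / 2\<close>, the values 0 and -1 are
    impossible.\<close>
  have step: "q = 1 \<and> d = b \<or> q = 2 \<and> d = 2 * b \<or> q = -2 \<and> d + 2 * b = N"
    if "q \<in> {-2, -1, 0, 1, 2}" and "N dvd d - q * b" for q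
  proof -
    have D: "d - q * b = - N \<or> d - q * b = 0 \<or> d - q * b = N"
      by (rule dvd_small_cases) (use that bounds in auto)
    have "q = -2 \<or> q = -1 \<or> q = 0 \<or> q = 1 \<or> q = 2" using that(1) by auto
    then show ?thesis by (elim disjE; use D bounds(3,4,8,9) in \<open>simp; linarith\<close>)
  qed
  have "j - i \<in> {-2, -1, 0, 1, 2}" "k - j \<in> {-2, -1, 0, 1, 2}" using ijk(1,2,3) by auto
  moreover have "N dvd d - (j - i) * b" "N dvd d - (k - j) * b"
    using dvds(2,3) by (simp_all add: algebra_simps)
  ultimately have steps: "j - i = 1 \<and> d = b \<or> j - i = 2 \<and> d = 2 * b \<or> j - i = -2 \<and> d + 2 * b = N"
    "k - j = 1 \<and> d = b \<or> k - j = 2 \<and> d = 2 * b \<or> k - j = -2 \<and> d + 2 * b = N"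
    using step by blast+
  have start: "c - (a + i * b) = - N \<or> c - (a + i * b) = 0 \<or> c - (a + i * b) = N"
    by (rule dvd_small_cases) (use dvds(1) ijk(1) bounds in auto)
  have ranges: "0 \<le> i" "i \<le> 2" "0 \<le> j" "j \<le> 2" "0 \<le> k" "k \<le> 2" using ijk(1,2,3) by auto
  \<comment> \<open>The surviving triples \<open>(i, j, k)\<close> are (0, 1, 2) and, only for
    \<open>3 * b = N\<close>, (1, 2, 0) and (2, 0, 1). Combinations involving
    \<open>d = 2 * b\<close> leave the range of positions or give \<open>2 * d = N\<close>.\<close>
  have "d = b" and wrap: "i = 0 \<or> 3 * b = N"
    using steps ranges bounds(3,4,8,9) by linarith+
  have "i = 0 \<or> i = 1 \<or> i = 2" using ijk(1) by simp
  then have "a = c \<and> b = d"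
    by (elim disjE; use start wrap bounds \<open>d = b\<close> in \<open>simp; linarith?\<close>)
  then show "a = c \<and> b = d" .
qed

text \<open>Every progression can be normalised: reversal brings the difference below
  \<open>N / 2\<close>, and the start is then reduced modulo \<open>N\<close>, or modulo
  \<open>b\<close> when \<open>3 * b = N\<close>.\<close>

lemma three_aps_eq:
  assumes "n > 0"
  shows "three_aps n = ap_set (int n) ` ap_index (int n)"
proof -
  define N where "N = int n"
  have N: "N > 0" using assms by (simp add: N_def)
  have "three_aps n = {P. card P = 3 \<and> (\<exists>a\<in>{0..<N}. \<exists>b\<in>{0<..<N}. P = ap_set N (a, b))}"
  proof -
    have 1: "carrier (residue_ring N) = {0..<N}" "\<zero>\<^bsub>residue_ring N\<^esub> = 0"
      "x \<oplus>\<^bsub>residue_ring N\<^esub> y = (x + y) mod N" for x y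
      by (auto simp: residue_ring_def)
    have "{0..<N} - {0} = {0<..<N}" by auto
    have 2: "{a, (a + b) mod N, (a + (b + b) mod N) mod N} = ap_set N (a, b)"
      if "a \<in> {0..<N}" for a b
      using that by (auto simp: ap_set_def mod_simps)
    show ?thesis
      unfolding three_aps_def N_def[symmetric] Let_def 1 \<open>{0..<N} - {0} = {0<..<N}\<close>
      by (intro Collect_cong conj_cong refl bex_cong) (simp only: 2)
  qed
  also have "\<dots> = ap_set N ` ap_index N"
  proof (intro equalityI subsetI)
    fix P assume "P \<in> {P. card P = 3 \<and> (\<exists>a\<in>{0..<N}. \<exists>b\<in>{0<..<N}. P = ap_set N (a, b))}"
    then obtain a b where P: "card P = 3" "P = ap_set N (a, b)" and ab: "0 < b" "b < N"
      by auto
    have "2 * b \<noteq> N"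
    proof
      assume "2 * b = N"
      then have "P = {a mod N, (a + b) mod N}" using P(2) by (auto simp: ap_set_def)
      then have "card P \<le> 2" using card_insert_le_m1[of 2 "{(a + b) mod N}" "a mod N"] by simp
      then show False using P(1) by simp
    qed
    obtain a b where P: "P = ap_set N (a, b)" and b: "0 < b" "2 * b < N"
    proof (cases "2 * b < N")
      case True
      then show ?thesis using that P ab by blast
    next
      case False
      \<comment> \<open>The same progression read backwards from its last term.\<close>
      have "P = ap_set N (a + 2 * b, N - b)"
      proof -
        have "a + 2 * b + (N - b) = a + b + N" "a + 2 * b + 2 * (N - b) = a + N * 2" by simp_all
        then have "(a + 2 * b + (N - b)) mod N = (a + b) mod N"
          "(a + 2 * b + 2 * (N - b)) mod N = a mod N"
          by (simp_all only: mod_add_self2 mod_mult_self2)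
        then show ?thesis unfolding P(2) ap_set_def by (simp add: insert_commute)
      qed
      then show ?thesis using that[of "a + 2 * b" "N - b"] False \<open>2 * b \<noteq> N\<close> ab by simp
    qed
    show "P \<in> ap_set N ` ap_index N"
    proof (cases "3 * b = N")
      case False
      have "P = ap_set N (a mod N, b)" unfolding P ap_set_def by (simp add: mod_simps)
      moreover have "(a mod N, b) \<in> ap_index N" using False b N by (simp add: ap_index_def)
      ultimately show ?thesis by blast
    next
      case True
      define a' where "a' = a mod N"
      have a': "0 \<le> a'" "a' < 3 * b" using N True by (simp_all add: a'_def)
      have Pa': "P = ap_set N (a', b)" unfolding P ap_set_def a'_def by (simp add: mod_simps)
      \<comment> \<open>The start changes by a multiple of \<open>b = N / 3\<close>, which only
        rotates the three terms.\<close>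
      have "P = ap_set N (a' mod b, b)"
      proof -
        consider "a' < b" | "b \<le> a'" "a' < 2 * b" | "2 * b \<le> a'" "a' < 3 * b" using a' by linarith
        then show ?thesis
        proof cases
          case 1
          then show ?thesis using Pa' a' by simp
        next
          case 2
          have m: "a' mod b = a' - b"
            using 2 b by (smt (verit) minus_mod_self2 mod_pos_pos_trivial)
          have "(a' + 2 * b) mod N = (a' - b) mod N"
            using True by (smt (verit) mod_add_self2)
          then show ?thesis using Pa' m by (auto simp: ap_set_def add.commute)
        next
          case 3
          have m: "a' mod b = a' - 2 * b"
            using 3 b by (smt (verit) minus_mod_self2 mod_pos_pos_trivial)
          have "(a' + 2 * b) mod N = (a' - b) mod N" "(a' + b) mod N = (a' - 2 * b) mod N"
            using True by (smt (verit) mod_add_self2)+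
          then show ?thesis using Pa' m by (auto simp: ap_set_def add.commute)
        qed
      qed
      moreover have "(a' mod b, b) \<in> ap_index N"
        using b N True pos_mod_bound[of b a'] pos_mod_sign[of b a']
        by (simp add: ap_index_def del: pos_mod_bound pos_mod_sign)
      ultimately show ?thesis by blast
    qed
  next
    fix P assume "P \<in> ap_set N ` ap_index N"
    then obtain a b where P: "P = ap_set N (a, b)" and ab: "0 \<le> a" "a < N" "0 < b" "2 * b < N"
      by (auto simp: ap_index_def)
    \<comment> \<open>Any two terms differ by \<open>b\<close> or \<open>2 * b\<close>, hence by
      less than \<open>N\<close>.\<close>
    have ne: "x mod N \<noteq> y mod N" if "0 < y - x" "y - x < N" for x y
      using that zdvd_not_zless[of "y - x" N] by (metis mod_eq_dvd_iff)
    have "a mod N \<noteq> (a + b) mod N" "a mod N \<noteq> (a + 2 * b) mod N"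
      "(a + b) mod N \<noteq> (a + 2 * b) mod N"
      by (rule ne; use ab in simp)+
    then have "card P = 3" by (simp add: P ap_set_def)
    then show "P \<in> {P. card P = 3 \<and> (\<exists>a\<in>{0..<N}. \<exists>b\<in>{0<..<N}. P = ap_set N (a, b))}"
      unfolding P by (intro CollectI conjI bexI[of _ a] bexI[of _ b]) (use ab P in auto)
  qed
  finally show ?thesis by (simp add: N_def)
qed

section \<open>Sums of periodic functions on the integers\<close>

lemma periodic_add_multiple:
  fixes f :: "int \<Rightarrow> 'a"
  assumes "\<And>x. f (x + k) = f x"
  shows "f (x + m * k) = f x"
proof -
  have *: "f (x + int i * k) = f x" for x i
    by (induction i) (simp_all add: assms ring_distribs add.assoc[symmetric], metis add.commute add.assoc assms)
  show ?thesis
  proof (cases "m \<ge> 0")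
    case True
    then show ?thesis using *[of x "nat m"] by simp
  next
    case False
    then show ?thesis using *[of "x + m * k" "nat (- m)"] by simp
  qed
qed

lemma periodic_mod:
  fixes f :: "int \<Rightarrow> 'a"
  assumes "\<And>x. f (x + k) = f x"
  shows "f (x mod k) = f x"
  using periodic_add_multiple[of f k "x mod k" "x div k", OF assms] by simp

lemma sum_int_shift:
  fixes f :: "int \<Rightarrow> int"
  shows "(\<Sum>x\<in>{c..<c + r}. f x) = (\<Sum>x\<in>{0..<r}. f (x + c))"
  by (rule sum.reindex_bij_witness[where i = "\<lambda>x. x + c" and j = "\<lambda>x. x - c"]) auto

text \<open>The remainder \<open>r\<close> allows for an incomplete last period; the block sums take
  \<open>r = d mod 4\<close>, the other uses take \<open>r = 0\<close>.\<close>

lemma sum_periods: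
  fixes f :: "int \<Rightarrow> int"
  assumes per: "\<And>x. f (x + k) = f x" and "0 \<le> k" "0 \<le> r"
  shows "(\<Sum>x\<in>{0..<int m * k + r}. f x) = int m * (\<Sum>x\<in>{0..<k}. f x) + (\<Sum>x\<in>{0..<r}. f x)"
proof (induction m)
  case (Suc m)
  have "0 \<le> int m * k" using assms(2) by simp
  then have "{0..<int (Suc m) * k + r} = {0..<k} \<union> {k..<k + (int m * k + r)}"
    using assms(2,3) by (simp add: ivl_disj_un_two(3) ring_distribs add.assoc)
  then have "(\<Sum>x\<in>{0..<int (Suc m) * k + r}. f x)
      = (\<Sum>x\<in>{0..<k}. f x) + (\<Sum>x\<in>{k..<k + (int m * k + r)}. f x)"
    by (simp add: sum.union_disjoint ivl_disj_int)
  also have "(\<Sum>x\<in>{k..<k + (int m * k + r)}. f x) = (\<Sum>x\<in>{0..<int m * k + r}. f x)"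
    unfolding sum_int_shift by (simp add: per)
  finally show ?case unfolding Suc by (simp add: ring_distribs)
qed simp

lemma sum_periodic_shift:
  fixes f :: "int \<Rightarrow> int"
  assumes "0 < N" and "\<And>x. f (x + N) = f x"
  shows "(\<Sum>x\<in>{0..<N}. f (x + c)) = (\<Sum>x\<in>{0..<N}. f x)"
  by (rule sum.reindex_bij_witness[where i = "\<lambda>x. (x - c) mod N" and j = "\<lambda>x. (x + c) mod N"])
    (use assms in \<open>auto simp: mod_simps periodic_mod\<close>)

text \<open>For odd \<open>N\<close>, \<open>(N + 1) div 2\<close> inverts 2 modulo
  \<open>N\<close>, so doubling permutes the residues.\<close>

lemma sum_periodic_double_odd:
  fixes f :: "int \<Rightarrow> int"
  assumes "0 < N" "odd N" and "\<And>x. f (x + N) = f x"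
  shows "(\<Sum>x\<in>{0..<N}. f (2 * x)) = (\<Sum>x\<in>{0..<N}. f x)"
proof -
  have half: "2 * ((N + 1) div 2) = N + 1" using assms(2) by presburger
  have inv: "(N + 1) div 2 * (2 * x) mod N = x mod N" "2 * ((N + 1) div 2 * x) mod N = x mod N" for x
  proof -
    have "(N + 1) div 2 * (2 * x) = x + x * N" "2 * ((N + 1) div 2 * x) = x + x * N"
      using half by (metis mult.assoc mult.commute distrib_right mult_1 add.commute)+
    then show "(N + 1) div 2 * (2 * x) mod N = x mod N" "2 * ((N + 1) div 2 * x) mod N = x mod N"
      by (simp_all only: mod_mult_self1)
  qed
  show ?thesis
    by (rule sum.reindex_bij_witness[where i = "\<lambda>x. ((N + 1) div 2 * x) mod N" and j = "\<lambda>x. (2 * x) mod N"])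
      (use assms(1,3) in \<open>auto simp: mod_mult_right_eq inv periodic_mod simp del: mult.assoc\<close>)
qed

lemma sum_double_eq_sum_even:
  fixes f :: "int \<Rightarrow> int"
  shows "(\<Sum>x\<in>{0..<h}. f (2 * x)) = (\<Sum>x\<in>{0..<2 * h}. of_bool (even x) * f x)"
proof -
  have "(\<Sum>x\<in>{0..<2 * h}. of_bool (even x) * f x) = (\<Sum>x\<in>{x\<in>{0..<2 * h}. even x}. f x)"
    by (rule sum.mono_neutral_cong_right) auto
  also have "\<dots> = (\<Sum>x\<in>{0..<h}. f (2 * x))"
    by (rule sum.reindex_bij_witness[where i = "\<lambda>x. 2 * x" and j = "\<lambda>x. x div 2"]) auto
  finally show ?thesis by simp
qed

text \<open>For even \<open>N\<close>, doubling maps the residues two-to-one onto the even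
  residues.\<close>

lemma sum_periodic_double_even:
  fixes f :: "int \<Rightarrow> int"
  assumes "0 < N" "even N" and per: "\<And>x. f (x + N) = f x"
  shows "(\<Sum>x\<in>{0..<N}. f (2 * x)) = 2 * (\<Sum>x\<in>{0..<N}. of_bool (even x) * f x)"
proof -
  obtain h where h: "N = 2 * h" using assms(2) by blast
  then show ?thesis
    using sum_periods[of "\<lambda>x. f (2 * x)" h 0 2] assms sum_double_eq_sum_even[of f h]
    by (simp add: ring_distribs)
qed

lemma odd_square_ge_1:
  fixes z :: int
  assumes "odd z"
  shows "1 \<le> z\<^sup>2"
  using assms by (metis even_zero int_one_le_iff_zero_less zero_less_power2)

section \<open>The count as a quadratic form in colour sums\<close>

locale periodic_coloring =
  fixes N :: int and X :: "int \<Rightarrow> int"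
  assumes pos: "0 < N"
    and periodic: "X (x + N) = X x"
    and sign: "X x = 1 \<or> X x = -1"
begin

definition corr :: "int \<Rightarrow> int" where
  "corr b = (\<Sum>a\<in>{0..<N}. X a * X (a + b))"

definition mono :: "int \<Rightarrow> int \<Rightarrow> bool" where
  "mono a b \<longleftrightarrow> X a = X (a + b) \<and> X (a + b) = X (a + 2 * b)"

text \<open>Counts starting points rather than sets: it makes sense for every \<open>b\<close>,
  including the degenerate 0 and \<open>N div 2\<close>, and for \<open>3 * b = N\<close> it counts
  each progression three times.\<close>

definition mono_count :: "int \<Rightarrow> int" where
  "mono_count b = (\<Sum>a\<in>{0..<N}. of_bool (mono a b))"

definition total :: int where
  "total = (\<Sum>a\<in>{0..<N}. X a)"

definition even_total :: int where
  "even_total = (\<Sum>a\<in>{0..<N}. of_bool (even a) * X a)"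

definition odd_total :: int where
  "odd_total = (\<Sum>a\<in>{0..<N}. of_bool (odd a) * X a)"

lemma total_split: "total = even_total + odd_total"
  unfolding total_def even_total_def odd_total_def sum.distrib[symmetric]
  by (rule sum.cong) auto

lemma periodic': "X (N + x) = X x" "X (x + (y + N)) = X (x + y)"
  by (metis add.commute periodic) (metis add.assoc periodic)

lemma sum_X_shift: "(\<Sum>a\<in>{0..<N}. X (a + c)) = total"
  unfolding total_def by (rule sum_periodic_shift[OF pos, where f = X, OF periodic])

lemma mono_count_le: "mono_count b \<le> N"
proof -
  have "mono_count b \<le> (\<Sum>a\<in>{0..<N}. 1)"
    unfolding mono_count_def by (rule sum_mono) simp
  then show ?thesis using pos by simp
qed

lemma mono_count_eqI:
  assumes "\<And>a. mono a b"
  shows "mono_count b = N"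
  using assms pos by (simp add: mono_count_def)

lemma corr_periodic: "corr (b + N) = corr b"
  by (simp add: corr_def periodic' )

lemma corr_minus: "corr (- b) = corr b"
proof -
  have "corr (- b) = (\<Sum>a\<in>{0..<N}. X (a + b) * X (a + b + - b))"
    unfolding corr_def
    by (rule sum_periodic_shift[OF pos, symmetric]) (simp add: periodic' periodic add.assoc[symmetric], metis add.commute add_diff_eq periodic')
  then show ?thesis by (simp add: corr_def mult.commute)
qed

text \<open>For signs x, y, z the expression 1 + xy + yz + xz is 4 if they agree and 0 otherwise.
  Summed over \<open>a\<close>, each product of neighbours becomes \<open>corr b\<close> and the
  outer product becomes \<open>corr (2 * b)\<close>.\<close>

lemma four_mono_count: "4 * mono_count b = N + 2 * corr b + corr (2 * b)"
proof -
  have pt: "4 * of_bool (mono a b) = 1 + X a * X (a + b) + X (a + b) * X (a + b + b) + X a * X (a + 2 * b)" for a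
    using sign[of a] sign[of "a + b"] sign[of "a + 2 * b"]
    by (auto simp: mono_def add.assoc)
  have "(\<Sum>a\<in>{0..<N}. X (a + b) * X (a + b + b)) = corr b"
    unfolding corr_def
    by (rule sum_periodic_shift[OF pos, where f = "\<lambda>a. X a * X (a + b)"])
      (metis add.assoc add.commute periodic)
  then show ?thesis
    unfolding mono_count_def sum_distrib_left pt sum.distrib
    using pos by (simp add: corr_def)
qed

lemma mono_count_zero: "mono_count 0 = N"
  by (rule mono_count_eqI) (simp add: mono_def)

lemma mono_count_reflect: "mono_count (N - b) = mono_count b"
proof -
  have "corr (N - b) = corr b"
    using corr_periodic[of "- b"] by (simp add: corr_minus)
  moreover have "corr (2 * (N - b)) = corr (2 * b)"
    using corr_periodic[of "- (2 * b)"] corr_periodic[of "- (2 * b) + N"] corr_minus[of "2 * b"]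
    by (simp add: algebra_simps)
  ultimately show ?thesis using four_mono_count[of "N - b"] four_mono_count[of b] by simp
qed

text \<open>After the sums are swapped, the inner sum over \<open>b\<close> is \<open>total\<close>
  for every \<open>a\<close>.\<close>

lemma sum_corr: "(\<Sum>b\<in>{0..<N}. corr b) = total\<^sup>2"
proof -
  have "(\<Sum>b\<in>{0..<N}. corr b) = (\<Sum>a\<in>{0..<N}. X a * (\<Sum>b\<in>{0..<N}. X (b + a)))"
    unfolding corr_def by (subst sum.swap) (simp add: sum_distrib_left add.commute)
  then show ?thesis
    unfolding sum_X_shift sum_distrib_right[symmetric] total_def[symmetric]
    by (simp add: power2_eq_square)
qed

lemma sum_corr_double:
  "(\<Sum>b\<in>{0..<N}. corr (2 * b)) = (\<Sum>a\<in>{0..<N}. X a * (\<Sum>b\<in>{0..<N}. X (2 * b + a)))"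
  unfolding corr_def by (subst sum.swap) (simp add: sum_distrib_left add.commute)

lemma sum_corr_double_odd:
  assumes "odd N"
  shows "(\<Sum>b\<in>{0..<N}. corr (2 * b)) = total\<^sup>2"
proof -
  have "(\<Sum>b\<in>{0..<N}. X (2 * b + a)) = total" for a
    using sum_periodic_double_odd[OF pos assms, of "\<lambda>x. X (x + a)"] sum_X_shift[of a]
    by (metis (no_types, lifting) add.assoc add.commute periodic)
  then show ?thesis
    unfolding sum_corr_double by (simp add: sum_distrib_right[symmetric] total_def[symmetric] power2_eq_square)
qed

lemma sum_parity_shift:
  assumes "even N"
  shows "(\<Sum>x\<in>{0..<N}. of_bool (even x) * X (x + a)) = (if even a then even_total else odd_total)"
proof -
  \<comment> \<open>Writing \<open>x\<close> as \<open>x + a - a\<close> makes the summand a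
    function of \<open>x + a\<close>; evenness of \<open>N\<close> makes its parity factor
    \<open>N\<close>-periodic.\<close>
  have "(\<Sum>x\<in>{0..<N}. of_bool (even (x + a - a)) * X (x + a))
      = (\<Sum>x\<in>{0..<N}. of_bool (even (x - a)) * X x)"
    by (rule sum_periodic_shift[OF pos, where f = "\<lambda>x. of_bool (even (x - a)) * X x"])
      (use assms in \<open>simp add: periodic\<close>)
  then show ?thesis by (auto simp: even_total_def odd_total_def)
qed

text \<open>For fixed \<open>a\<close>, the values \<open>2 * b + a\<close> run twice through the
  residues with the parity of \<open>a\<close>, so colours are multiplied only within one parity
  class.\<close>

lemma sum_corr_double_even:
  assumes "even N"
  shows "(\<Sum>b\<in>{0..<N}. corr (2 * b)) = 2 * even_total\<^sup>2 + 2 * odd_total\<^sup>2"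
proof -
  have "(\<Sum>b\<in>{0..<N}. X (2 * b + a)) = 2 * (if even a then even_total else odd_total)" for a
    unfolding sum_parity_shift[OF assms, symmetric]
    by (rule sum_periodic_double_even[OF pos assms, of "\<lambda>x. X (x + a)"])
      (metis add.assoc add.commute periodic)
  then have "(\<Sum>b\<in>{0..<N}. corr (2 * b))
      = (\<Sum>a\<in>{0..<N}. 2 * even_total * (of_bool (even a) * X a) + 2 * odd_total * (of_bool (odd a) * X a))"
    unfolding sum_corr_double by (intro sum.cong) auto
  then show ?thesis
    unfolding sum.distrib sum_distrib_left[symmetric] even_total_def[symmetric] odd_total_def[symmetric]
    by (simp add: power2_eq_square)
qed

lemma sum_mono_count:
  "4 * (\<Sum>b\<in>{0..<N}. mono_count b) = N\<^sup>2 + 2 * total\<^sup>2 +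
     (if even N then 2 * even_total\<^sup>2 + 2 * odd_total\<^sup>2 else total\<^sup>2)"
  unfolding sum_distrib_left four_mono_count sum.distrib
  using pos
  by (simp add: sum_distrib_left[symmetric] sum_corr sum_corr_double_odd sum_corr_double_even power2_eq_square)

text \<open>Differences \<open>b\<close> and \<open>N - b\<close> pair up with equal counts. The
  fixed points of this pairing modulo \<open>N\<close> are 0, whose count is \<open>N\<close>, and
  \<open>N div 2\<close> for even \<open>N\<close>.\<close>

lemma sum_mono_count_split:
  "(\<Sum>b\<in>{0..<N}. mono_count b)
    = N + 2 * (\<Sum>b | 0 < b \<and> 2 * b < N. mono_count b) + (if even N then mono_count (N div 2) else 0)"
proof -
  define H where "H = {b. 0 < b \<and> 2 * b < N}"
  define M where "M = (if even N then {N div 2} else {})"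
  have fin: "finite H" by (rule finite_subset[of _ "{0..N}"]) (auto simp: H_def)
  have "{0..<N} = {0} \<union> (H \<union> (\<lambda>b. N - b) ` H \<union> M)"
  proof (intro equalityI subsetI)
    fix b assume b: "b \<in> {0..<N}"
    consider "b = 0" | "b \<in> H" | "N - b \<in> H" | "2 * b = N"
      using b by (force simp: H_def)
    then show "b \<in> {0} \<union> (H \<union> (\<lambda>b. N - b) ` H \<union> M)"
    proof cases
      case 3
      then have "N - (N - b) \<in> (\<lambda>b. N - b) ` H" by blast
      then show ?thesis by simp
    qed (auto simp: M_def)
  qed (use pos in \<open>auto simp: H_def M_def split: if_splits\<close>)
  moreover have "{0} \<inter> (H \<union> (\<lambda>b. N - b) ` H \<union> M) = {}" "H \<inter> (\<lambda>b. N - b) ` H = {}"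
    "(H \<union> (\<lambda>b. N - b) ` H) \<inter> M = {}"
    using pos by (auto simp: H_def M_def split: if_splits)
  moreover have "(\<Sum>b\<in>(\<lambda>b. N - b) ` H. mono_count b) = (\<Sum>b\<in>H. mono_count b)"
    by (subst sum.reindex) (auto simp: inj_on_def mono_count_reflect)
  ultimately have "(\<Sum>b\<in>{0..<N}. mono_count b)
    = mono_count 0 + ((\<Sum>b\<in>H. mono_count b) + (\<Sum>b\<in>H. mono_count b) + (\<Sum>b\<in>M. mono_count b))"
    using fin by (simp add: sum.union_disjoint M_def)
  then show ?thesis by (simp add: H_def M_def mono_count_zero)
qed

text \<open>With difference \<open>N / 3\<close>, starts that differ by \<open>b\<close> lie in the
  same coset, so \<open>mono a b\<close> has period \<open>b\<close> in \<open>a\<close>.\<close>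

lemma mono_count_third:
  assumes "N = 3 * b"
  shows "mono_count b = 3 * (\<Sum>a\<in>{0..<b}. of_bool (mono a b))"
proof -
  have "mono (x + b) b = mono x b" for x
    using periodic[of x] by (auto simp: mono_def assms algebra_simps)
  then have "(\<Sum>a\<in>{0..<int 3 * b + 0}. of_bool (mono a b)) = int 3 * (\<Sum>a\<in>{0..<b}. of_bool (mono a b))
      + (\<Sum>a\<in>{0..<0::int}. of_bool (mono a b) :: int)"
    by (intro sum_periods) (use pos assms in simp_all)
  moreover have "{0..<int 3 * b + 0} = {0..<N}" by (simp add: assms)
  ultimately show ?thesis by (simp only: mono_count_def) simp
qed

text \<open>The factor 24 clears the denominators of \<^const>\<open>bound_constants\<close>.\<close>

lemma card_mono_index:
  "24 * int (card {(a, b) \<in> ap_index N. mono a b})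
    = 3 * N\<^sup>2 - 12 * N + 6 * total\<^sup>2 + (if even N then 6 * even_total\<^sup>2 + 6 * odd_total\<^sup>2 else 3 * total\<^sup>2)
      - (if even N then 12 * mono_count (N div 2) else 0)
      - (if 3 dvd N then 16 * mono_count (N div 3) else 0)"
proof -
  define H where "H = {b. 0 < b \<and> 2 * b < N}"
  define A where "A b = {a \<in> {0..<N}. (3 * b = N \<longrightarrow> a < b) \<and> mono a b}" for b
  have fin: "finite H" by (rule finite_subset[of _ "{0..N}"]) (auto simp: H_def)
  have "{(a, b) \<in> ap_index N. mono a b} = (\<lambda>(b, a). (a, b)) ` (SIGMA b:H. A b)"
    by (auto simp: ap_index_def H_def A_def image_iff)
  then have "card {(a, b) \<in> ap_index N. mono a b} = card (SIGMA b:H. A b)"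
    by (simp add: card_image inj_on_def split_beta prod_eq_iff)
  also have "\<dots> = (\<Sum>b\<in>H. card (A b))"
    by (rule card_SigmaI) (use fin in \<open>auto simp: A_def intro: finite_subset[of _ "{0..<N}"]\<close>)
  finally have card: "int (card {(a, b) \<in> ap_index N. mono a b}) = (\<Sum>b\<in>H. int (card (A b)))"
    by simp
  \<comment> \<open>At \<open>b = N div 3\<close> only a third of the starts is indexed; the factor
    3 avoids division and leaves an excess of two counts to subtract.\<close>
  have A: "3 * int (card (A b)) = 3 * mono_count b - (if b = N div 3 then if 3 dvd N then 2 * mono_count (N div 3) else 0 else 0)"
    if "b \<in> H" for b
  proof (cases "3 * b = N")
    case True
    then have "A b = {0..<b} \<inter> {a. mono a b}" using pos by (auto simp: A_def)
    then have "int (card (A b)) = (\<Sum>a\<in>{0..<b}. of_bool (mono a b))" by simp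
    then have "mono_count b = 3 * int (card (A b))" using mono_count_third[of b] True by simp
    then show ?thesis using True by auto
  next
    case False
    then have "A b = {0..<N} \<inter> {a. mono a b}" by (auto simp: A_def)
    then have "int (card (A b)) = mono_count b" by (simp add: mono_count_def)
    moreover have "\<not> (b = N div 3 \<and> 3 dvd N)" using False by auto
    ultimately show ?thesis by auto
  qed
  have "3 * (\<Sum>b\<in>H. int (card (A b)))
    = 3 * (\<Sum>b\<in>H. mono_count b) - (if 3 dvd N then 2 * mono_count (N div 3) else 0)"
  proof -
    have "N div 3 \<in> H" if "3 dvd N" using that pos by (auto simp: H_def)
    then show ?thesis
      unfolding sum_distrib_left
      using fin by (simp add: A sum_subtractf sum.delta)
  qed
  \<comment> \<open>Eight times this identity is used. The sum over \<open>H\<close> is half of what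
    remains of the full sum after removing \<open>N\<close> and the term at \<open>N div 2\<close>,
    whence the coefficients 12 and 16.\<close>
  with card sum_mono_count sum_mono_count_split show ?thesis
    unfolding H_def[symmetric] by (simp split: if_splits)
qed

section \<open>Parity constraints and the lower bound\<close>

lemma even_sum_signs: "even (\<Sum>x\<in>{0..<m}. X (g x)) \<longleftrightarrow> even m" if "0 \<le> m" for m :: int
proof -
  have "even (X (g x) - 1)" for x using sign[of "g x"] by auto
  then have "even (\<Sum>x\<in>{0..<m}. X (g x) - 1)" by (intro dvd_sum)
  moreover have "int (card {0..<m}) = m" using that by simp
  ultimately show ?thesis by (simp add: sum_subtractf)
qed

lemma odd_total_iff: "odd total \<longleftrightarrow> odd N"
  using even_sum_signs[of N "\<lambda>x. x"] pos by (simp add: total_def)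

text \<open>\<open>even_total\<close> is a sum of \<open>N div 2\<close> signs, an odd number of
  them; \<open>total\<close> is even, so \<open>odd_total\<close> is odd too.\<close>

lemma odd_parity_totals:
  assumes "N mod 4 = 2"
  shows "odd even_total" "odd odd_total"
proof -
  obtain h where h: "N = 2 * h" "odd h" "0 < h"
  proof
    show "N = 2 * (N div 2)" "odd (N div 2)" "0 < N div 2" using assms pos by presburger+
  qed
  have "even_total = (\<Sum>x\<in>{0..<h}. X (2 * x))"
    using sum_double_eq_sum_even[of X h] by (simp only: even_total_def h(1)[symmetric])
  then show "odd even_total" using even_sum_signs[of h "\<lambda>x. 2 * x"] h by simp
  moreover have "even total" using odd_total_iff h by simp
  ultimately show "odd odd_total" by (simp add: total_split)
qed

text \<open>A shift by the odd period \<open>h\<close> exchanges even and odd residues but keeps the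
  colours.\<close>

lemma parity_totals_eq:
  assumes "odd h" "even N" and "\<And>x. X (x + h) = X x"
  shows "even_total = odd_total"
  using sum_parity_shift[OF assms(2), of h] assms by (simp add: even_total_def)

text \<open>Starts \<open>a\<close> and \<open>a + h\<close> describe the same pair of residues, so
  the counted starts come in twos.\<close>

lemma even_mono_count_half:
  assumes "N = 2 * h"
  shows "even (mono_count h)"
proof -
  have "mono (x + h) h = mono x h" for x
    using periodic[of x] periodic[of "x + h"] by (auto simp: mono_def assms algebra_simps)
  then have "(\<Sum>a\<in>{0..<int 2 * h + 0}. of_bool (mono a h)) = int 2 * (\<Sum>a\<in>{0..<h}. of_bool (mono a h))
      + (\<Sum>a\<in>{0..<0::int}. of_bool (mono a h) :: int)"
    by (intro sum_periods) (use pos assms in simp_all)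
  moreover have "{0..<int 2 * h + 0} = {0..<N}" by (simp add: assms)
  ultimately show ?thesis by (simp only: mono_count_def) simp
qed

lemma mono_count_eqD:
  assumes "mono_count b = N"
  shows "X (x + b) = X x"
proof -
  have "(\<Sum>a\<in>{0..<N}. 1 - of_bool (mono a b) :: int) = 0"
    using assms pos by (simp only: sum_subtractf mono_count_def[symmetric]) simp
  then have "\<forall>a\<in>{0..<N}. 1 - of_bool (mono a b) = (0 :: int)"
    by (subst (asm) sum_nonneg_eq_0_iff) auto
  then have "mono (x mod N) b" using pos by auto
  then have "X (x mod N + b) = X (x mod N)" by (simp add: mono_def)
  moreover have "X (x mod N) = X x" "X (x mod N + b) = X (x + b)"
    by (rule periodic_mod[of X N, OF periodic], rule periodic_mod[of "\<lambda>x. X (x + b)" N])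
      (metis add.assoc add.commute periodic)
  ultimately show ?thesis by simp
qed

text \<open>Each subtracted count is at most \<open>N\<close>. For odd \<open>N\<close>, the odd
  number \<open>total\<close> enters squared with coefficient 6 + 3 = 9. For
  \<open>N mod 4 = 2\<close>, the count at \<open>N div 2\<close> is weighed against the
  squares.\<close>

lemma card_mono_index_lower:
  "3 * N\<^sup>2 - (if even N then 24 * N else 12 * N) - (if 3 dvd N then 16 * N else 0)
     + (if odd N then 9 else if N mod 4 = 2 then if 3 dvd N then 12 else 36 else 0)
   \<le> 24 * int (card {(a, b) \<in> ap_index N. mono a b})"
proof (cases "even N")
  case False
  then have "1 \<le> total\<^sup>2" using odd_total_iff by (simp add: odd_square_ge_1)
  then show ?thesis
    using False mono_count_le[of "N div 3"] by (simp add: card_mono_index)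
next
  case True
  let ?c = "card {(a, b) \<in> ap_index N. mono a b}"
  let ?Q = "total\<^sup>2 + even_total\<^sup>2 + odd_total\<^sup>2"
  have c: "24 * int ?c = 3 * N\<^sup>2 - 12 * N + 6 * ?Q - 12 * mono_count (N div 2)
      - (if 3 dvd N then 16 * mono_count (N div 3) else 0)"
    using True by (simp add: card_mono_index)
  have le: "mono_count (N div 2) \<le> N" "mono_count (N div 3) \<le> N" by (rule mono_count_le)+
  show ?thesis
  proof (cases "N mod 4 = 2")
    case False
    define Q w where "Q = ?Q" and "w = mono_count (N div 2)"
    have "0 \<le> Q" by (simp add: Q_def)
    then show ?thesis using True False c[folded Q_def w_def] le[folded w_def] by (simp split: if_splits)
  next
    case 2: True
    define w where "w = mono_count (N div 2)"
    have ge: "1 \<le> even_total\<^sup>2" "1 \<le> odd_total\<^sup>2"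
      using odd_parity_totals[OF 2] by (simp_all add: odd_square_ge_1)
    have nonneg: "0 \<le> total\<^sup>2" by simp
    \<comment> \<open>If \<open>w < N\<close>, parity gives \<open>w \<le> N - 2\<close>, which adds
      4 to the two odd squares. If \<open>w = N\<close>, then \<open>even_total = odd_total\<close>
      and the three squares sum to \<open>6 * even_total\<^sup>2\<close>. Six times this bound
      yields the constant 36.\<close>
    have "6 \<le> ?Q + 2 * (N - w)"
    proof (cases "w = N")
      case False
      moreover have "even w"
        using even_mono_count_half[of "N div 2"] True by (simp add: w_def)
      ultimately have "2 \<le> N - w" using le(1)[folded w_def] True by presburger
      then show ?thesis using ge nonneg by (smt (verit))
    next
      case half: True
      have "even_total = odd_total"
        using mono_count_eqD[OF half[unfolded w_def]] 2 True by (intro parity_totals_eq[of "N div 2"]) presburger+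
      then have "total = 2 * even_total" using total_split by simp
      then have "total\<^sup>2 = 4 * even_total\<^sup>2" by (simp add: power_mult_distrib)
      then show ?thesis using ge half by simp
    qed
    then show ?thesis using True 2 c[folded w_def] le[folded w_def] ge nonneg by (simp split: if_splits)
  qed
qed

end

section \<open>From colourings of residues to periodic colourings\<close>

text \<open>Injectivity of \<open>ap_set\<close> turns the count of sets into a count of index
  pairs.\<close>

lemma card_mono_three_aps:
  assumes "n > 0" "periodic_coloring (int n) (\<lambda>x. \<chi> (x mod int n))"
  shows "card {P \<in> three_aps n. monochromatic \<chi> P}
    = card {(a, b) \<in> ap_index (int n). periodic_coloring.mono (\<lambda>x. \<chi> (x mod int n)) a b}"
proof -
  interpret periodic_coloring "int n" "\<lambda>x. \<chi> (x mod int n)" by (rule assms)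
  have "{P \<in> three_aps n. monochromatic \<chi> P} = ap_set (int n) ` {(a, b) \<in> ap_index (int n). mono a b}"
    unfolding three_aps_eq[OF assms(1)]
    by (auto simp: monochromatic_def mono_def ap_set_def)
  moreover have "inj_on (ap_set (int n)) {(a, b) \<in> ap_index (int n). mono a b}"
    by (rule inj_on_subset[OF inj_on_ap_set]) auto
  ultimately show ?thesis by (simp add: card_image)
qed

lemma periodic_coloring_two_colorings:
  assumes "n > 0" "\<chi> \<in> two_colorings n"
  shows "periodic_coloring (int n) (\<lambda>x. \<chi> (x mod int n))"
proof
  fix x
  have "x mod int n \<in> carrier (residue_ring (int n))"
    using assms(1) by (simp add: residue_ring_def)
  then have "\<chi> (x mod int n) \<in> {-1, 1}"
    using assms(2) unfolding two_colorings_def by blast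
  then show "\<chi> (x mod int n) = 1 \<or> \<chi> (x mod int n) = -1" by auto
qed (use assms in simp_all)

lemma finite_two_colorings: "finite (two_colorings n)"
  by (auto simp: two_colorings_def residue_ring_def intro!: finite_PiE)

section \<open>The block pattern and its count\<close>

text \<open>Positions 0 and 2 of a block have opposite signs, as have 1 and 3. Whole blocks
  therefore cancel in the total and in each parity class, and the sums over \<open>{0..<d}\<close>
  depend only on \<open>d mod 4\<close>.\<close>

definition block_sign :: "int \<Rightarrow> int" where
  "block_sign x = (if x mod 4 \<in> {0, 3} then 1 else -1)"

lemma block_sign_add_4: "block_sign (x + 4) = block_sign x"
  by (simp add: block_sign_def)

lemma int_eq_4_times_plus:
  fixes d :: int
  assumes "0 \<le> d"
  shows "d = int (nat (d div 4)) * 4 + d mod 4"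
  using assms by simp

lemma sum_block_sign:
  assumes "0 \<le> d"
  shows "(\<Sum>x\<in>{0..<d}. block_sign x) = (\<Sum>x\<in>{0..<d mod 4}. block_sign x)"
proof -
  have "{0..<4::int} = {0, 1, 2, 3}" by auto
  then have "(\<Sum>x\<in>{0..<4}. block_sign x) = 0" by (simp add: block_sign_def)
  then show ?thesis
    using sum_periods[of block_sign 4 "d mod 4" "nat (d div 4)", OF block_sign_add_4]
      int_eq_4_times_plus[OF assms] by simp
qed

lemma sum_even_block_sign:
  assumes "0 \<le> d"
  shows "(\<Sum>x\<in>{0..<d}. of_bool (even x) * block_sign x)
    = (\<Sum>x\<in>{0..<d mod 4}. of_bool (even x) * block_sign x)"
proof -
  have "{0..<4::int} = {0, 1, 2, 3}" by auto
  then have "(\<Sum>x\<in>{0..<4}. of_bool (even x) * block_sign x) = 0" by (simp add: block_sign_def)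
  then show ?thesis
    using sum_periods[of "\<lambda>x. of_bool (even x) * block_sign x" 4 "d mod 4" "nat (d div 4)"]
      int_eq_4_times_plus[OF assms] by (simp add: block_sign_add_4)
qed

text \<open>The incomplete block is + or + - -, with sum 1 or -1; squaring covers both.\<close>

lemma sum_block_sign_odd:
  assumes "0 \<le> d" "odd d"
  shows "(\<Sum>x\<in>{0..<d}. block_sign x)\<^sup>2 = 1"
proof -
  have "{0..<3::int} = {0, 1, 2}" "{0..<1::int} = {0}" by auto
  moreover have "d mod 4 = 1 \<or> d mod 4 = 3" using assms(2) by presburger
  ultimately show ?thesis
    unfolding sum_block_sign[OF assms(1)] by (elim disjE) (simp_all add: block_sign_def)
qed

lemma sum_block_sign_even:
  assumes "0 \<le> d" "even d"
  shows "(\<Sum>x\<in>{0..<d}. block_sign x) = 0"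
    and "(\<Sum>x\<in>{0..<d}. of_bool (even x) * block_sign x) = (if d mod 4 = 2 then 1 else 0)"
proof -
  have "{0..<2::int} = {0, 1}" by auto
  moreover have "d mod 4 = 0 \<or> d mod 4 = 2" using assms(2) by presburger
  ultimately show "(\<Sum>x\<in>{0..<d}. block_sign x) = 0"
    and "(\<Sum>x\<in>{0..<d}. of_bool (even x) * block_sign x) = (if d mod 4 = 2 then 1 else 0)"
    unfolding sum_block_sign[OF assms(1)] sum_even_block_sign[OF assms(1)]
    by (auto simp: block_sign_def)
qed

text \<open>The pattern is cut off at length \<open>d\<close> and repeated \<open>k\<close> times,
  restarting at each multiple of \<open>d\<close> even if 4 does not divide
  \<open>d\<close>.\<close>

locale block_coloring =
  fixes k :: nat and d :: int
  assumes d_pos: "0 < d" and k_pos: "0 < k"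
begin

sublocale periodic_coloring "int k * d" "\<lambda>x. block_sign (x mod d)"
proof
  show "0 < int k * d" using d_pos k_pos by simp
qed (auto simp: block_sign_def)

lemma total_eq: "total = int k * (\<Sum>x\<in>{0..<d}. block_sign x)"
proof -
  have "total = (\<Sum>x\<in>{0..<int k * d + 0}. block_sign (x mod d))" by (simp add: total_def)
  also have "\<dots> = int k * (\<Sum>x\<in>{0..<d}. block_sign (x mod d)) + (\<Sum>x\<in>{0..<0}. block_sign (x mod d))"
    by (rule sum_periods) (use d_pos in simp_all)
  finally show ?thesis by simp
qed

lemma even_total_eq:
  assumes "even d"
  shows "even_total = int k * (\<Sum>x\<in>{0..<d}. of_bool (even x) * block_sign x)"
proof -
  have "even_total = (\<Sum>x\<in>{0..<int k * d + 0}. of_bool (even x) * block_sign (x mod d))"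
    by (simp add: even_total_def)
  also have "\<dots> = int k * (\<Sum>x\<in>{0..<d}. of_bool (even x) * block_sign (x mod d))
      + (\<Sum>x\<in>{0..<0}. of_bool (even x) * block_sign (x mod d))"
    by (rule sum_periods[where f = "\<lambda>x. of_bool (even x) * block_sign (x mod d)"])
      (use d_pos assms in simp_all)
  finally show ?thesis by simp
qed

lemma mono_if_dvd: "mono a b" if "d dvd b"
proof -
  have "(a + b) mod d = a mod d" "(a + 2 * b) mod d = a mod d"
    using that by (simp_all add: mod_eq_dvd_iff)
  then show ?thesis by (simp add: mono_def)
qed

text \<open>As \<open>m\<close> divides \<open>k\<close>, the difference is a multiple of the period
  \<open>d\<close>. The degenerate counts thus reach the maximum used in the lower bound.\<close>

lemma mono_count_div:
  assumes "m dvd k" "0 < m"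
  shows "mono_count (int k * d div int m) = int k * d"
proof (rule mono_count_eqI, rule mono_if_dvd)
  show "d dvd int k * d div int m" using assms by (auto elim!: dvdE simp: mult.assoc)
qed

text \<open>Here \<open>total\<close> is \<open>k\<close> or \<open>-k\<close> and enters squared
  with coefficient 6 + 3 = 9.\<close>

lemma card_mono_index_odd:
  assumes "odd k" "odd d" "3 dvd int k * d \<Longrightarrow> 3 dvd k"
  shows "24 * int (card {(a, b) \<in> ap_index (int k * d). mono a b})
    = 3 * (int k * d)\<^sup>2 - 12 * (int k * d) - (if 3 dvd int k * d then 16 * (int k * d) else 0) + 9 * (int k)\<^sup>2"
proof -
  have "total\<^sup>2 = (int k)\<^sup>2"
    using sum_block_sign_odd[of d] d_pos assms(2) by (simp add: total_eq power_mult_distrib)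
  then show ?thesis
    using assms mono_count_div[of 3] by (simp add: card_mono_index)
qed

text \<open>For odd \<open>d\<close>, the two parity sums are equal, each half of
  \<open>total\<close>, and \<open>total\<close> is \<open>k\<close> or \<open>-k\<close>: the
  squares give 6 + 3/2 + 3/2 = 9. For even \<open>d\<close>, \<open>total\<close> vanishes and the
  parity sums are \<open>k\<close> and \<open>-k\<close> if \<open>d mod 4 = 2\<close>, else
  0.\<close>

lemma card_mono_index_even:
  assumes "even k" "3 dvd int k * d \<Longrightarrow> 3 dvd k"
  shows "24 * int (card {(a, b) \<in> ap_index (int k * d). mono a b})
    = 3 * (int k * d)\<^sup>2 - 24 * (int k * d) - (if 3 dvd int k * d then 16 * (int k * d) else 0)
      + (if odd d then 9 * (int k)\<^sup>2 else if d mod 4 = 2 then 12 * (int k)\<^sup>2 else 0)"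
proof -
  have "6 * total\<^sup>2 + 6 * even_total\<^sup>2 + 6 * odd_total\<^sup>2
      = (if odd d then 9 * (int k)\<^sup>2 else if d mod 4 = 2 then 12 * (int k)\<^sup>2 else 0)"
  proof (cases "even d")
    case False
    have "total\<^sup>2 = (int k)\<^sup>2"
      using sum_block_sign_odd[of d] d_pos False by (simp add: total_eq power_mult_distrib)
    moreover have "even_total = odd_total"
      by (rule parity_totals_eq[of d]) (use False assms in simp_all)
    moreover from this have "total\<^sup>2 = 4 * even_total\<^sup>2"
      unfolding total_split by (simp add: power2_eq_square)
    ultimately show ?thesis using False by simp
  next
    case True
    have "total = 0" using sum_block_sign_even(1)[of d] d_pos True by (simp add: total_eq)
    moreover have "even_total = (if d mod 4 = 2 then int k else 0)"
      using sum_block_sign_even(2)[of d] d_pos True by (simp add: even_total_eq)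
    ultimately show ?thesis using True total_split by (auto simp: add_eq_0_iff)
  qed
  then show ?thesis
    using assms mono_count_div[of 3] mono_count_div[of 2] by (simp add: card_mono_index)
qed

end

section \<open>Bounds for the minimum\<close>

lemma min_mono_three_aps_in:
  obtains \<chi> where "\<chi> \<in> two_colorings n"
    and "min_mono_three_aps n = card {P \<in> three_aps n. monochromatic \<chi> P}"
proof -
  have "restrict (\<lambda>_. 1) (carrier (residue_ring (int n))) \<in> two_colorings n"
    by (simp add: two_colorings_def)
  then have "min_mono_three_aps n \<in> (\<lambda>\<chi>. card {P \<in> three_aps n. monochromatic \<chi> P}) ` two_colorings n"
    unfolding min_mono_three_aps_def by (intro Min_in) (auto simp: finite_two_colorings)
  then show ?thesis using that by blast
qed

lemma min_mono_three_aps_lower: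
  fixes n :: nat
  defines "N \<equiv> int n"
  assumes "n > 0"
  shows "3 * N\<^sup>2 - (if even N then 24 * N else 12 * N) - (if 3 dvd N then 16 * N else 0)
     + (if odd N then 9 else if N mod 4 = 2 then if 3 dvd N then 12 else 36 else 0)
   \<le> 24 * int (min_mono_three_aps n)"
proof -
  obtain \<chi> where \<chi>: "\<chi> \<in> two_colorings n"
    "min_mono_three_aps n = card {P \<in> three_aps n. monochromatic \<chi> P}"
    by (rule min_mono_three_aps_in)
  have col: "periodic_coloring (int n) (\<lambda>x. \<chi> (x mod int n))"
    by (rule periodic_coloring_two_colorings[OF assms(2) \<chi>(1)])
  show ?thesis
    unfolding \<chi>(2) card_mono_three_aps[OF assms(2) col] N_def
    by (rule periodic_coloring.card_mono_index_lower[OF col])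
qed

text \<open>With this \<open>k\<close>, the period \<open>n / k\<close> divides \<open>n / 2\<close>
  and \<open>n / 3\<close> whenever these are integers. The remaining error is a multiple of the
  square of \<open>k\<close>.\<close>

lemma min_mono_three_aps_upper:
  fixes n k :: nat
  defines "N \<equiv> int n"
  assumes "n > 0" and k: "k = (if even n then 2 else 1) * (if 3 dvd n then 3 else 1)"
  shows "24 * int (min_mono_three_aps n)
    \<le> 3 * N\<^sup>2 - (if even N then 24 * N else 12 * N) - (if 3 dvd N then 16 * N else 0)
     + (if n mod 4 = 0 then if n mod 8 = 4 then 12 * (int k)\<^sup>2 else 0 else 9 * (int k)\<^sup>2)"
proof -
  have "k dvd n" unfolding k by (simp; presburger)
  then obtain e where e: "n = k * e" by blast
  then have N: "N = int k * int e" by (simp add: N_def)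
  have kpos: "0 < k" by (simp add: k)
  interpret block_coloring k "int e"
    by unfold_locales (use e assms(2) kpos in \<open>auto intro: Nat.gr0I\<close>)
  define \<chi> where "\<chi> = restrict (\<lambda>x. block_sign (x mod int e)) (carrier (residue_ring (int n)))"
  have "\<chi> \<in> two_colorings n"
    by (auto simp: \<chi>_def two_colorings_def block_sign_def)
  then have le: "min_mono_three_aps n \<le> card {P \<in> three_aps n. monochromatic \<chi> P}"
    unfolding min_mono_three_aps_def by (intro Min_le) (auto simp: finite_two_colorings)
  \<comment> \<open>Since \<open>e\<close> divides \<open>n\<close>, reducing modulo
    \<open>n\<close> first does not affect the residue modulo \<open>e\<close>.\<close>
  have "int e dvd int n" using e by simp
  then have eq: "(\<lambda>x. \<chi> (x mod int n)) = (\<lambda>x. block_sign (x mod int e))"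
    using assms(2) by (auto simp: \<chi>_def residue_ring_def mod_mod_cancel)
  have col: "periodic_coloring (int n) (\<lambda>x. \<chi> (x mod int n))"
    by (rule periodic_coloring_two_colorings[OF assms(2) \<open>\<chi> \<in> two_colorings n\<close>])
  have card: "card {P \<in> three_aps n. monochromatic \<chi> P}
      = card {(a, b) \<in> ap_index (int k * int e). mono a b}"
    unfolding card_mono_three_aps[OF assms(2) col] eq by (simp add: N[unfolded N_def])
  have three: "3 dvd k" if "3 dvd int k * int e"
  proof -
    have "3 dvd n" using that e by (metis int_dvd_int_iff of_nat_mult of_nat_numeral)
    then show ?thesis by (simp add: k)
  qed
  have "24 * int (card {P \<in> three_aps n. monochromatic \<chi> P})
    = 3 * N\<^sup>2 - (if even N then 24 * N else 12 * N) - (if 3 dvd N then 16 * N else 0)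
     + (if n mod 4 = 0 then if n mod 8 = 4 then 12 * (int k)\<^sup>2 else 0 else 9 * (int k)\<^sup>2)"
  proof (cases "even n")
    case False
    then have odd: "odd k" "odd (int e)" "odd N" using e N_def by auto
    have "n mod 4 \<noteq> 0" using False by presburger
    show ?thesis
      using card_mono_index_odd[OF odd(1,2) three] odd(3) \<open>n mod 4 \<noteq> 0\<close>
      unfolding card N[symmetric] by simp
  next
    case True
    have even: "even k" "even N" using True by (simp_all add: k N_def)
    have "k = 2 \<or> k = 6" using True by (simp add: k)
    \<comment> \<open>Treats \<open>k = 2\<close> and \<open>k = 6\<close> together: the factor 3
      preserves parity and the property of being 2 modulo 4.\<close>
    then obtain m where m: "n = 2 * m" "m = e \<or> m = 3 * e" using e by fastforce
    have "n mod 4 = 0 \<longleftrightarrow> even m" unfolding m(1) by presburger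
    also have "\<dots> \<longleftrightarrow> even e" using m(2) by auto
    finally have four: "n mod 4 = 0 \<longleftrightarrow> even e" .
    have "n mod 8 = 4 \<longleftrightarrow> m mod 4 = 2" unfolding m(1) by presburger
    moreover have "3 * e mod 4 = 2 \<longleftrightarrow> e mod 4 = 2" by presburger
    then have "m mod 4 = 2 \<longleftrightarrow> e mod 4 = 2" using m(2) by auto
    ultimately have eight: "n mod 8 = 4 \<longleftrightarrow> e mod 4 = 2" by simp
    have "int e mod 4 = 2 \<longleftrightarrow> e mod 4 = 2" by presburger
    then show ?thesis
      using card_mono_index_even[OF even(1) three] even(2)
      unfolding card N[symmetric] four eight by (auto split: if_splits)
  qed
  then show ?thesis using le by linarith
qed

text \<open>Rewrites the table through the parity of \<open>n\<close>, divisibility by 3 and the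
  residues modulo 4 and 8, the form in which the integer bounds are stated. All these depend on
  \<open>n mod 24\<close> only, so 24 cases suffice.\<close>

lemma bound_constants_times_24:
  assumes "(c1, c2, c3) = bound_constants n"
    and "k = (if even n then 2 else 1) * (if 3 dvd n then 3 else 1)"
  shows "24 * c1 = (if even n then 24 else 12) + (if 3 dvd n then 16 else 0)"
    and "24 * c2 = (if odd n then 9 else if n mod 4 = 2 then if 3 dvd n then 12 else 36 else 0)"
    and "24 * c3 = (if n mod 4 = 0 then if n mod 8 = 4 then 12 * (real k)\<^sup>2 else 0 else 9 * (real k)\<^sup>2)"
proof -
  define r where "r = n mod 24"
  have "even n \<longleftrightarrow> even r" "3 dvd n \<longleftrightarrow> 3 dvd r" "n mod 4 = r mod 4" "n mod 8 = r mod 8"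
    unfolding r_def by (simp_all add: dvd_mod_iff mod_mod_cancel)
  note residues = this
  have "r < 24" by (simp add: r_def)
  then have "r \<in> {..<24}" by simp
  then have "r \<in> {0, 1, 2, 3, 4, 5, 6, 7, 8, 9, 10, 11, 12, 13, 14, 15, 16, 17, 18, 19, 20, 21, 22, 23}"
    by (simp add: lessThan_nat_numeral lessThan_Suc del: lessThan_iff) blast
  then have "24 * c1 = (if even n then 24 else 12) + (if 3 dvd n then 16 else 0)
    \<and> 24 * c2 = (if odd n then 9 else if n mod 4 = 2 then if 3 dvd n then 12 else 36 else 0)
    \<and> 24 * c3 = (if n mod 4 = 0 then if n mod 8 = 4 then 12 * (real k)\<^sup>2 else 0 else 9 * (real k)\<^sup>2)"
    using assms(1) unfolding assms(2) residues bound_constants_def r_def[symmetric] Let_def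
    by (simp only: insert_iff empty_iff) (elim disjE; simp)
  then show "24 * c1 = (if even n then 24 else 12) + (if 3 dvd n then 16 else 0)"
    "24 * c2 = (if odd n then 9 else if n mod 4 = 2 then if 3 dvd n then 12 else 36 else 0)"
    "24 * c3 = (if n mod 4 = 0 then if n mod 8 = 4 then 12 * (real k)\<^sup>2 else 0 else 9 * (real k)\<^sup>2)"
    by blast+
qed

theorem theorem1:
  fixes n :: nat and c1 c2 c3 :: real
  assumes "n > 0"
    and "(c1, c2, c3) = bound_constants n"
  shows "(real n)\<^sup>2 / 8 - c1 * real n + c2 \<le> real (min_mono_three_aps n)
       \<and> real (min_mono_three_aps n) \<le> (real n)\<^sup>2 / 8 - c1 * real n + c3"
proof -
  define k :: nat where "k = (if even n then 2 else 1) * (if 3 dvd n then 3 else 1)"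
  note c = bound_constants_times_24[OF assms(2) k_def]
  have dvd: "3 dvd int n \<longleftrightarrow> 3 dvd n" "int n mod 4 = 2 \<longleftrightarrow> n mod 4 = 2"
    by presburger+
  have c1: "24 * (c1 * real n) = (if even n then 24 * real n else 12 * real n) + (if 3 dvd n then 16 * real n else 0)"
    using c(1) by (simp add: mult.assoc[symmetric] split: if_splits)
  have "real_of_int (3 * (int n)\<^sup>2 - (if even (int n) then 24 * int n else 12 * int n)
      - (if 3 dvd int n then 16 * int n else 0)
      + (if odd (int n) then 9 else if int n mod 4 = 2 then if 3 dvd int n then 12 else 36 else 0))
     \<le> real_of_int (24 * int (min_mono_three_aps n))"
    using min_mono_three_aps_lower[OF assms(1)] by (simp only: of_int_le_iff)
  then have "3 * (real n)\<^sup>2 - 24 * (c1 * real n) + 24 * c2 \<le> 24 * real (min_mono_three_aps n)"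
    unfolding c1 c(2) dvd by (simp split: if_splits)
  moreover have "real_of_int (24 * int (min_mono_three_aps n))
    \<le> real_of_int (3 * (int n)\<^sup>2 - (if even (int n) then 24 * int n else 12 * int n)
      - (if 3 dvd int n then 16 * int n else 0)
      + (if n mod 4 = 0 then if n mod 8 = 4 then 12 * (int k)\<^sup>2 else 0 else 9 * (int k)\<^sup>2))"
    using min_mono_three_aps_upper[OF assms(1) k_def] by (simp only: of_int_le_iff)
  then have "24 * real (min_mono_three_aps n) \<le> 3 * (real n)\<^sup>2 - 24 * (c1 * real n) + 24 * c3"
    unfolding c1 c(3) dvd by (simp split: if_splits)
  ultimately show ?thesis by simp
qed

end
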